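(* Let $r$ be a positive integer. If $r$ is odd, then \[ \log F_r = \sum_{k = 0}^\infty {\frac{1}{{\alpha ^{4rk} }}\sum_{j = 1}^r {\frac{{\beta ^{4j - 2} (r - 2 + r\,\delta _{j,(r + 1)/2} )}}{{2rk + 2j - 1}}} } + \sum_{k = 0}^\infty {\frac{1}{{\alpha ^{4rk} }}\sum_{j = 1}^{r - 1} {\frac{{\beta ^{4j}\, r}}{{2rk + 2j}}} }. \] If $r$ is even, then \[ \log F_r = \sum_{k = 0}^\infty {\frac{1}{{\alpha ^{4rk} }}\sum_{j = 1}^r {\frac{{(r - 2)\beta ^{4j - 2} }}{{2rk + 2j - 1}}} } + \sum_{k = 0}^\infty {\frac{1}{{\alpha ^{4rk} }}\sum_{j = 1}^{r - 1} {\frac{{\beta ^{4j}\, r\,(1 - \delta _{j,r/2} )}}{{2rk + 2j}}} }. \]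
   Context: $\alpha=(1+\sqrt5)/2$ is the golden ratio and $\beta=-1/\alpha=(1-\sqrt5)/2$. The Fibonacci numbers are $F_n=(\alpha^n-\beta^n)/\sqrt5$. $\delta_{m,n}$ is the Kronecker delta (equal to $1$ if $m=n$ and $0$ otherwise); $\log$ is the natural logarithm. *)

theory Defs
  imports "HOL-Analysis.Analysis" "HOL-Number_Theory.Fib"
begin

definition golden :: real  (\<open>\<alpha>\<close>)
  where "\<alpha> = (1 + sqrt 5) / 2"

definition golden_conj :: real  (\<open>\<beta>\<close>)
  where "\<beta> = - 1 / \<alpha>"

definition kdelta :: "nat \<Rightarrow> nat \<Rightarrow> real"  (\<open>\<delta>\<close>)
  where "\<delta> m n = (if m = n then 1 else 0)"

lemma golden_conj_eq: "\<beta> = (1 - sqrt 5) / 2"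
proof -
  have "1 + sqrt 5 \<noteq> 0" using real_sqrt_ge_zero[of 5] by linarith
  moreover have "(1 - sqrt 5) * (1 + sqrt 5) = - 4"
    by (simp add: algebra_simps)
  ultimately show ?thesis
    by (simp add: golden_conj_def golden_def field_simps)
qed

text \<open>Binet's formula: the recursively defined library function \<open>fib\<close> is the sequence
  \<open>(\<alpha>\<^sup>n - \<beta>\<^sup>n) / sqrt 5\<close>.\<close>

lemma fib_binet: "real (fib n) = (\<alpha> ^ n - \<beta> ^ n) / sqrt 5"
  using fib_closed_form[of n]
  by (simp add: golden_def golden_conj_eq)

end

theory Submission
  imports Defs
begin

text \<open>
  Put \<open>q = \<beta>\<^sup>2 = 1 / \<alpha>\<^sup>2\<close>. Every summand has the form \<open>q ^ m / m\<close>, and \<open>k\<close>, \<open>j\<close> merely split the odd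
  (resp. even) exponents \<open>m\<close> into blocks of length \<open>r\<close>. The delta terms and the missing index
  \<open>j = r\<close> in the even sum pick out the multiples of \<open>r\<close>, which form a logarithmic series in \<open>q ^ r\<close>.
  Hence the right-hand side is \<open>- r ln (1 - q) + ln ((1 - q) / (1 + q)) + ln (1 \<plusminus> q ^ r)\<close>, and
  \<open>1 - q = 1 / \<alpha>\<close>, \<open>1 + q = sqrt 5 / \<alpha>\<close> turn this into Binet's formula.
\<close>

section \<open>Logarithmic series over odd and over even exponents, and their grouping into
  blocks\<close>

text \<open>Subtracting the series of \<open>ln (1 - x)\<close> from that of
  \<open>ln (1 + x)\<close> cancels the even exponents and doubles the odd ones.\<close>

lemma sums_odd_powers:
  fixes x :: real
  assumes "\<bar>x\<bar> < 1"
  shows "(\<lambda>i. x ^ (2 * i + 1) / real (2 * i + 1)) sums ((ln (1 + x) - ln (1 - x)) / 2)"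
proof -
  have "(\<lambda>n. - ((-x) ^ n) / real n - (- ((- (- x)) ^ n) / real n)) sums (ln (1 + x) - ln (1 + - x))"
    using assms by (intro sums_diff ln_series') auto
  \<comment> \<open>Pairing the indices \<open>2 * i\<close> and \<open>2 * i + 1\<close> leaves one
    nonzero term per pair.\<close>
  from sums_group[OF this, of 2]
  have "(\<lambda>i. 2 * (x ^ (2 * i + 1) / real (2 * i + 1))) sums (2 * ((ln (1 + x) - ln (1 - x)) / 2))"
    by (simp add: mult.commute del: right_diff_distrib_numeral)
  then show ?thesis
    by (simp only: sums_mult_iff[OF zero_neq_numeral[symmetric]])
qed

text \<open>Up to the factor \<open>1 / 2\<close> this is the logarithmic series at
  \<open>- x\<^sup>2\<close>, and \<open>1 - x\<^sup>2\<close> factors as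
  \<open>(1 + x) * (1 - x)\<close>.\<close>

lemma sums_even_powers:
  fixes x :: real
  assumes "\<bar>x\<bar> < 1"
  shows "(\<lambda>i. x ^ (2 * i + 2) / real (2 * i + 2)) sums (- (ln (1 + x) + ln (1 - x)) / 2)"
proof -
  have x2: "x\<^sup>2 < 1"
    using assms by (simp add: abs_square_less_1)
  have "(1 + x) * (1 - x) = 1 + - x\<^sup>2"
    by (simp add: algebra_simps power2_eq_square)
  then have ln: "ln (1 + x) + ln (1 - x) = ln (1 + - x\<^sup>2)"
    using assms by (simp flip: ln_mult_pos)
  have "(\<lambda>n. - ((- (- x\<^sup>2)) ^ n) / real n) sums ln (1 + - x\<^sup>2)"
    using x2 by (intro ln_series') auto
  \<comment> \<open>The dropped term at index 0 is zero because division by zero yields 0.\<close>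
  then have "(\<lambda>n. - ((- (- x\<^sup>2)) ^ Suc n) / real (Suc n)) sums ln (1 + - x\<^sup>2)"
    by (subst sums_Suc_iff) simp
  from sums_mult[OF this, of "- 1 / 2"]
  have "(\<lambda>n. - 1 / 2 * (- ((- (- x\<^sup>2)) ^ Suc n) / real (Suc n))) sums (- (ln (1 + x) + ln (1 - x)) / 2)"
    by (simp add: ln)
  moreover have "- 1 / 2 * (- ((- (- x\<^sup>2)) ^ Suc n) / real (Suc n)) = x ^ (2 * n + 2) / real (2 * n + 2)" for n
  proof -
    have "real (2 * n + 2) = 2 * real (Suc n)"
      by simp
    moreover have "x ^ (2 * n + 2) = (x\<^sup>2) ^ Suc n"
      by (simp add: power_mult power2_eq_square)
    ultimately show ?thesis
      by simp
  qed
  ultimately show ?thesis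
    by simp
qed

text \<open>Block \<open>k\<close> consists of the indices from \<open>r * k\<close> to
  \<open>r * k + r - 1\<close>. The shift by 1 makes the inner index start at 1, so the subtraction
  never truncates.\<close>

lemma sums_blocks:
  fixes f :: "nat \<Rightarrow> 'a::real_normed_vector"
  assumes "f sums s" "0 < r"
  shows "(\<lambda>k. \<Sum>j = 1..r. f (r * k + j - 1)) sums s"
proof -
  have "(\<Sum>j = 1..r. f (r * k + j - 1)) = sum f {k * r..<k * r + r}" for k
    by (rule sum.reindex_bij_witness[of _ "\<lambda>i. i + 1 - r * k" "\<lambda>j. r * k + j - 1"])
      (auto simp: mult.commute)
  with sums_group[OF assms] show ?thesis
    by simp
qed

section \<open>The golden ratio and the logarithm of Binet's formula\<close>

lemma golden_gt_1: "\<alpha> > 1"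
  using real_less_rsqrt[of 1 5] by (simp add: golden_def)

lemma golden_conj_square:
  shows "\<beta>\<^sup>2 = inverse \<alpha> ^ 2" "1 - \<beta>\<^sup>2 = 1 / \<alpha>" "1 + \<beta>\<^sup>2 = sqrt 5 / \<alpha>"
proof -
  show "\<beta>\<^sup>2 = inverse \<alpha> ^ 2"
    by (simp add: golden_conj_def field_simps)
  have inv: "1 / \<alpha> = - \<beta>"
    by (simp add: golden_conj_def)
  have "\<beta>\<^sup>2 = 1 + \<beta>"
    by (simp add: golden_conj_eq power2_eq_square field_simps)
  then show "1 - \<beta>\<^sup>2 = 1 / \<alpha>"
    by (simp add: inv)
  have "sqrt 5 * (- \<beta>) = 1 + \<beta>\<^sup>2"
    by (simp add: golden_conj_eq power2_eq_square field_simps)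
  then show "1 + \<beta>\<^sup>2 = sqrt 5 / \<alpha>"
    using inv by (simp add: divide_inverse)
qed

lemma golden_conj_square_bounds: "0 < \<beta>\<^sup>2" "\<beta>\<^sup>2 < 1"
proof -
  show "0 < \<beta>\<^sup>2"
    using golden_gt_1 by (simp add: golden_conj_def)
  have "1 - \<beta>\<^sup>2 > 0"
    using golden_gt_1 by (simp add: golden_conj_square(2))
  then show "\<beta>\<^sup>2 < 1"
    by simp
qed

text \<open>For \<open>m = r * k\<close> and \<open>n = 2 * j - 1\<close> or
  \<open>n = 2 * j\<close>, this merges the outer factor and the inner power of \<beta> into one
  power whose exponent equals the denominator of the summand.\<close>

lemma golden_power_shift:
  "\<beta> ^ (2 * n) / \<alpha> ^ (4 * m) = (\<beta>\<^sup>2) ^ (2 * m + n)"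
proof -
  have "(\<beta>\<^sup>2) ^ (2 * m) = 1 / \<alpha> ^ (4 * m)"
    by (simp add: golden_conj_square(1) power_inverse divide_inverse flip: power_mult)
  then show ?thesis
    by (simp add: power_add power_mult)
qed

text \<open>Since \<beta> equals \<open>- \<alpha> * q\<close>, Binet's formula factors as
  \<open>\<alpha> ^ r * (1 - (- q) ^ r) / sqrt 5\<close>. The logarithms of \<alpha> and
  \<open>sqrt 5\<close> are then expressed through \<open>1 - q\<close> and \<open>1 + q\<close>.
  The sign in \<open>(- q) ^ r\<close> is where the parity of \<open>r\<close> enters.\<close>

lemma ln_fib_eq:
  assumes "0 < r"
  defines "q \<equiv> \<beta>\<^sup>2"
  shows "ln (real (fib r)) = - real r * ln (1 - q) + (ln (1 - q) - ln (1 + q)) + ln (1 - (- q) ^ r)"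
proof -
  have "q ^ r < 1"
    using golden_conj_square_bounds assms by (simp add: power_less_one_iff)
  moreover have "(- q) ^ r \<le> q ^ r"
    using golden_conj_square_bounds(1) by (cases "even r") (auto simp: q_def)
  ultimately have pos: "1 - (- q) ^ r > 0"
    by linarith
  have "\<alpha> * (- q) = \<beta>"
    using golden_gt_1 by (simp add: q_def golden_conj_def power2_eq_square)
  then have "\<alpha> ^ r * (1 - (- q) ^ r) = \<alpha> ^ r - \<beta> ^ r"
    by (simp add: right_diff_distrib flip: power_mult_distrib)
  then have "real (fib r) = \<alpha> ^ r * (1 - (- q) ^ r) / sqrt 5"
    by (simp add: fib_binet)
  then have "ln (real (fib r)) = real r * ln \<alpha> + ln (1 - (- q) ^ r) - ln (sqrt 5)"
    using pos golden_gt_1 by (simp add: ln_div ln_mult ln_realpow)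
  then show ?thesis
    using golden_gt_1 by (simp add: q_def golden_conj_square(2,3) ln_div)
qed

section \<open>Block series at \<open>\<beta>\<^sup>2\<close>\<close>

lemma sum_kdelta:
  assumes "a \<in> A" "finite A"
  shows "(\<Sum>j\<in>A. f j * \<delta> j a) = f a"
  using assms by (simp add: kdelta_def if_distrib cong: if_cong)

lemma odd_blocks_sums:
  assumes "0 < r"
  shows "(\<lambda>k. \<Sum>j = 1..r. (\<beta>\<^sup>2) ^ (2 * (r * k) + (2 * j - 1)) / real (2 * r * k + 2 * j - 1)) sums
    ((ln (1 + \<beta>\<^sup>2) - ln (1 - \<beta>\<^sup>2)) / 2)"
proof -
  \<comment> \<open>Both sides of each equation use truncated subtraction, hence the restriction to
    \<open>j \<ge> 1\<close>.\<close>
  have ix: "2 * (r * k + j - 1) + 1 = 2 * (r * k) + (2 * j - 1)"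
    "2 * r * k + 2 * j - 1 = 2 * (r * k) + (2 * j - 1)" if "j \<in> {1..r}" for j k
    using that by auto
  have "\<bar>\<beta>\<^sup>2\<bar> < 1"
    using golden_conj_square_bounds by simp
  from sums_blocks[OF sums_odd_powers[OF this] assms] show ?thesis
    by (simp only: ix cong: sum.cong)
qed

text \<open>A full block would run up to \<open>j = r\<close>. Its last term, times
  \<open>r\<close>, is a term of the even series at \<open>(\<beta>\<^sup>2) ^ r\<close>, so that
  series is subtracted.\<close>

lemma even_blocks_sums:
  assumes "0 < r"
  shows "(\<lambda>k. \<Sum>j = 1..r - 1. (\<beta>\<^sup>2) ^ (2 * (r * k) + 2 * j) * real r / real (2 * r * k + 2 * j)) sums
    (real r * (- (ln (1 + \<beta>\<^sup>2) + ln (1 - \<beta>\<^sup>2)) / 2)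
      - (- (ln (1 + (\<beta>\<^sup>2) ^ r) + ln (1 - (\<beta>\<^sup>2) ^ r)) / 2))"
proof -
  let ?q = "\<beta>\<^sup>2"
  have q: "\<bar>?q\<bar> < 1" "\<bar>?q ^ r\<bar> < 1"
    using golden_conj_square_bounds assms by (auto simp: power_less_one_iff)
  let ?f = "\<lambda>i. ?q ^ (2 * i + 2) / real (2 * i + 2)"
  let ?g = "\<lambda>k. (?q ^ r) ^ (2 * k + 2) / real (2 * k + 2)"
  have "(\<lambda>k. real r * (\<Sum>j = 1..r. ?f (r * k + j - 1)) - ?g k) sums
      (real r * (- (ln (1 + ?q) + ln (1 - ?q)) / 2) - (- (ln (1 + ?q ^ r) + ln (1 - ?q ^ r)) / 2))"
    by (intro sums_diff sums_mult sums_blocks sums_even_powers q assms)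
  moreover have "real r * (\<Sum>j = 1..r. ?f (r * k + j - 1)) - ?g k =
      (\<Sum>j = 1..r - 1. ?q ^ (2 * (r * k) + 2 * j) * real r / real (2 * r * k + 2 * j))" for k
  proof -
    have ix: "2 * (r * k + j - 1) + 2 = 2 * (r * k) + 2 * j" if "1 \<le> j" for j
      using that by auto
    have "(\<Sum>j = 1..r. ?f (r * k + j - 1)) =
        (\<Sum>j = 1..r. ?q ^ (2 * (r * k) + 2 * j) / real (2 * (r * k) + 2 * j))"
      by (rule sum.cong) (simp_all only: atLeastAtMost_iff ix)
    also have "\<dots> = (\<Sum>j = 1..r - 1. ?q ^ (2 * (r * k) + 2 * j) / real (2 * (r * k) + 2 * j))
        + ?q ^ (2 * (r * k) + 2 * r) / real (2 * (r * k) + 2 * r)"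
      using assms by (cases r) simp_all
    finally have eq: "real r * (\<Sum>j = 1..r. ?f (r * k + j - 1)) =
        (\<Sum>j = 1..r - 1. ?q ^ (2 * (r * k) + 2 * j) * real r / real (2 * r * k + 2 * j))
        + real r * (?q ^ (2 * (r * k) + 2 * r) / real (2 * (r * k) + 2 * r))"
      by (simp add: distrib_left sum_distrib_left mult_ac)
    \<comment> \<open>At \<open>j = r\<close> the exponent is an even multiple of \<open>r\<close>,
      and the \<open>r\<close> in the denominator cancels the coefficient.\<close>
    have "2 * (r * k) + 2 * r = r * (2 * k + 2)"
      by (simp add: algebra_simps)
    then have "?q ^ (2 * (r * k) + 2 * r) = (?q ^ r) ^ (2 * k + 2)"
      by (simp only: power_mult)
    moreover have "real (2 * (r * k) + 2 * r) = real r * real (2 * k + 2)"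
      by (simp add: algebra_simps)
    ultimately have "real r * (?q ^ (2 * (r * k) + 2 * r) / real (2 * (r * k) + 2 * r)) = ?g k"
      using assms by simp
    with eq show ?thesis
      by simp
  qed
  ultimately show ?thesis
    by (simp only:)
qed

text \<open>These exponents are the odd multiples \<open>r * (2 * k + 1)\<close>; cancelling
  \<open>r\<close> leaves the odd series at \<open>(\<beta>\<^sup>2) ^ r\<close>. They are the terms
  selected by the Kronecker delta, among the odd exponents for odd \<open>r\<close> and among the
  even ones for even \<open>r\<close>.\<close>

lemma middle_terms_sums:
  assumes "0 < r"
  shows "(\<lambda>k. (\<beta>\<^sup>2) ^ (2 * (r * k) + r) * real r / real (2 * r * k + r)) sums
    ((ln (1 + (\<beta>\<^sup>2) ^ r) - ln (1 - (\<beta>\<^sup>2) ^ r)) / 2)"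
proof -
  have "\<bar>(\<beta>\<^sup>2) ^ r\<bar> < 1"
    using golden_conj_square_bounds assms by (auto simp: power_less_one_iff)
  moreover have "((\<beta>\<^sup>2) ^ r) ^ (2 * k + 1) / real (2 * k + 1) =
      (\<beta>\<^sup>2) ^ (2 * (r * k) + r) * real r / real (2 * r * k + r)" for k
  proof -
    have "2 * (r * k) + r = r * (2 * k + 1)"
      by (simp add: algebra_simps)
    then have "((\<beta>\<^sup>2) ^ r) ^ (2 * k + 1) = (\<beta>\<^sup>2) ^ (2 * (r * k) + r)"
      by (simp only: power_mult)
    moreover have "real (2 * r * k + r) = real r * real (2 * k + 1)"
      by (simp add: algebra_simps)
    ultimately show ?thesis
      using assms by simp
  qed
  ultimately show ?thesis
    using sums_odd_powers[of "(\<beta>\<^sup>2) ^ r"] by simp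
qed

section \<open>Assembling the series by the parity of \<open>r\<close>\<close>

text \<open>The \<open>summable\<close> conjuncts state convergence explicitly, because an equation
  between values of \<open>suminf\<close> does not imply it.\<close>

theorem theorem2p3:
  fixes r :: nat
  assumes "r > 0"
  shows
    "(odd r \<longrightarrow>
      summable (\<lambda>k. 1 / \<alpha> ^ (4 * r * k) * (\<Sum>j = 1..r. \<beta> ^ (4 * j - 2) * (real r - 2 + real r * \<delta> j ((r + 1) div 2)) / real (2 * r * k + 2 * j - 1))) \<and>
      summable (\<lambda>k. 1 / \<alpha> ^ (4 * r * k) * (\<Sum>j = 1..r - 1. \<beta> ^ (4 * j) * real r / real (2 * r * k + 2 * j))) \<and>
      ln (real (fib r)) =
        (\<Sum>k. 1 / \<alpha> ^ (4 * r * k) * (\<Sum>j = 1..r. \<beta> ^ (4 * j - 2) * (real r - 2 + real r * \<delta> j ((r + 1) div 2)) / real (2 * r * k + 2 * j - 1))) +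
        (\<Sum>k. 1 / \<alpha> ^ (4 * r * k) * (\<Sum>j = 1..r - 1. \<beta> ^ (4 * j) * real r / real (2 * r * k + 2 * j)))) \<and>
     (even r \<longrightarrow>
      summable (\<lambda>k. 1 / \<alpha> ^ (4 * r * k) * (\<Sum>j = 1..r. (real r - 2) * \<beta> ^ (4 * j - 2) / real (2 * r * k + 2 * j - 1))) \<and>
      summable (\<lambda>k. 1 / \<alpha> ^ (4 * r * k) * (\<Sum>j = 1..r - 1. \<beta> ^ (4 * j) * real r * (1 - \<delta> j (r div 2)) / real (2 * r * k + 2 * j))) \<and>
      ln (real (fib r)) =
        (\<Sum>k. 1 / \<alpha> ^ (4 * r * k) * (\<Sum>j = 1..r. (real r - 2) * \<beta> ^ (4 * j - 2) / real (2 * r * k + 2 * j - 1))) +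
        (\<Sum>k. 1 / \<alpha> ^ (4 * r * k) * (\<Sum>j = 1..r - 1. \<beta> ^ (4 * j) * real r * (1 - \<delta> j (r div 2)) / real (2 * r * k + 2 * j))))"
proof (intro conjI impI)
  let ?q = "\<beta>\<^sup>2"
  \<comment> \<open>\<open>O1\<close> collects all odd exponents, \<open>M\<close> the odd multiples
    of \<open>r\<close>, and \<open>E\<close> the even exponents with the even multiples of
    \<open>r\<close> removed.\<close>
  define O1 where "O1 = (ln (1 + ?q) - ln (1 - ?q)) / 2"
  define M where "M = (ln (1 + ?q ^ r) - ln (1 - ?q ^ r)) / 2"
  define E where "E = real r * (- (ln (1 + ?q) + ln (1 - ?q)) / 2)
      - (- (ln (1 + ?q ^ r) + ln (1 - ?q ^ r)) / 2)"
  note odd_blocks = odd_blocks_sums[OF assms, folded O1_def]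
  note middle = middle_terms_sums[OF assms, folded M_def]
  note even_blocks = even_blocks_sums[OF assms, folded E_def]
  \<comment> \<open>The free factor \<open>c\<close> stands for coefficient and denominator, so that
    the rewriting reaches every summand.\<close>
  have pow_odd: "1 / \<alpha> ^ (4 * r * k) * (\<beta> ^ (4 * j - 2) * c) = ?q ^ (2 * (r * k) + (2 * j - 1)) * c" for k j c
    unfolding golden_power_shift[symmetric] by (simp add: diff_mult_distrib2 mult.assoc)
  have pow_even: "1 / \<alpha> ^ (4 * r * k) * (\<beta> ^ (4 * j) * c) = ?q ^ (2 * (r * k) + 2 * j) * c" for k j c
    unfolding golden_power_shift[symmetric] by (simp add: mult.assoc)
  {
    assume "odd r"
    then have mid: "(r + 1) div 2 \<in> {1..r}" "2 * ((r + 1) div 2) - 1 = r"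
        "2 * r * k + 2 * ((r + 1) div 2) - 1 = 2 * r * k + r" for k
      by (auto elim!: oddE)
    have "1 / \<alpha> ^ (4 * r * k) * (\<Sum>j = 1..r. \<beta> ^ (4 * j - 2) * (real r - 2 + real r * \<delta> j ((r + 1) div 2)) / real (2 * r * k + 2 * j - 1))
       = (real r - 2) * (\<Sum>j = 1..r. ?q ^ (2 * (r * k) + (2 * j - 1)) / real (2 * r * k + 2 * j - 1))
         + ?q ^ (2 * (r * k) + r) * real r / real (2 * r * k + r)" (is "?L k = ?R k") for k
    proof -
      have "?L k = (\<Sum>j = 1..r. ?q ^ (2 * (r * k) + (2 * j - 1)) * ((real r - 2 + real r * \<delta> j ((r + 1) div 2)) / real (2 * r * k + 2 * j - 1)))"
        unfolding sum_distrib_left times_divide_eq_right[symmetric] pow_odd ..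
      also have "\<dots> = (\<Sum>j = 1..r. (real r - 2) * (?q ^ (2 * (r * k) + (2 * j - 1)) / real (2 * r * k + 2 * j - 1))
          + (?q ^ (2 * (r * k) + (2 * j - 1)) * real r / real (2 * r * k + 2 * j - 1)) * \<delta> j ((r + 1) div 2))"
        by (rule sum.cong) (simp_all add: add_divide_distrib distrib_left mult_ac)
      also have "\<dots> = ?R k"
        by (simp only: sum.distrib sum_distrib_left sum_kdelta[OF mid(1) finite_atLeastAtMost] mid(2,3))
      finally show ?thesis .
    qed
    then have S1: "?L sums ((real r - 2) * O1 + M)"
      using sums_add[OF sums_mult[OF odd_blocks, of "real r - 2"] middle] by simp
    show "summable ?L"
      using S1 by (rule sums_summable)
    have "1 / \<alpha> ^ (4 * r * k) * (\<Sum>j = 1..r - 1. \<beta> ^ (4 * j) * real r / real (2 * r * k + 2 * j))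
       = (\<Sum>j = 1..r - 1. ?q ^ (2 * (r * k) + 2 * j) * real r / real (2 * r * k + 2 * j))" (is "?L' k = _") for k
      unfolding sum_distrib_left times_divide_eq_right[symmetric] pow_even ..
    then have S2: "?L' sums E"
      using even_blocks by simp
    show "summable ?L'"
      using S2 by (rule sums_summable)
    \<comment> \<open>Adding \<open>M\<close> to the \<open>q ^ r\<close> part of \<open>E\<close>
      cancels \<open>ln (1 - q ^ r)\<close> and leaves \<open>ln (1 + q ^ r)\<close>, as odd
      \<open>r\<close> requires.\<close>
    have "ln (real (fib r)) = (real r - 2) * O1 + M + E"
      using \<open>odd r\<close> unfolding ln_fib_eq[OF assms] O1_def M_def E_def by (simp add: field_simps)
    then show "ln (real (fib r)) = (\<Sum>k. ?L k) + (\<Sum>k. ?L' k)"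
      using S1 S2 by (simp only: sums_unique[symmetric])
  next
    assume "even r"
    \<comment> \<open>A positive even \<open>r\<close> is at least 2, so the middle index survives
      the omission of \<open>j = r\<close>.\<close>
    with assms have mid: "r div 2 \<in> {1..r - 1}" "2 * (r div 2) = r"
      by (auto elim!: evenE)
    have "1 / \<alpha> ^ (4 * r * k) * (\<Sum>j = 1..r. (real r - 2) * \<beta> ^ (4 * j - 2) / real (2 * r * k + 2 * j - 1))
       = (real r - 2) * (\<Sum>j = 1..r. ?q ^ (2 * (r * k) + (2 * j - 1)) / real (2 * r * k + 2 * j - 1))" (is "?L k = ?R k") for k
    proof -
      have "?L k = (\<Sum>j = 1..r. 1 / \<alpha> ^ (4 * r * k) * (\<beta> ^ (4 * j - 2) * ((real r - 2) / real (2 * r * k + 2 * j - 1))))"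
        by (simp add: sum_distrib_left mult_ac)
      also have "\<dots> = ?R k"
        unfolding pow_odd by (simp add: sum_distrib_left mult_ac)
      finally show ?thesis .
    qed
    then have S1: "?L sums ((real r - 2) * O1)"
      using sums_mult[OF odd_blocks, of "real r - 2"] by simp
    show "summable ?L"
      using S1 by (rule sums_summable)
    have "1 / \<alpha> ^ (4 * r * k) * (\<Sum>j = 1..r - 1. \<beta> ^ (4 * j) * real r * (1 - \<delta> j (r div 2)) / real (2 * r * k + 2 * j))
       = (\<Sum>j = 1..r - 1. ?q ^ (2 * (r * k) + 2 * j) * real r / real (2 * r * k + 2 * j))
         - ?q ^ (2 * (r * k) + r) * real r / real (2 * r * k + r)" (is "?L' k = ?R' k") for k
    proof -
      have "?L' k = (\<Sum>j = 1..r - 1. ?q ^ (2 * (r * k) + 2 * j) * (real r * ((1 - \<delta> j (r div 2)) / real (2 * r * k + 2 * j))))"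
        unfolding sum_distrib_left times_divide_eq_right[symmetric] mult.assoc[of "\<beta> ^ _"] pow_even ..
      also have "\<dots> = (\<Sum>j = 1..r - 1. ?q ^ (2 * (r * k) + 2 * j) * real r / real (2 * r * k + 2 * j)
          - (?q ^ (2 * (r * k) + 2 * j) * real r / real (2 * r * k + 2 * j)) * \<delta> j (r div 2))"
        by (rule sum.cong) (simp_all add: diff_divide_distrib right_diff_distrib mult_ac)
      also have "\<dots> = ?R' k"
        by (simp only: sum_subtractf sum_kdelta[OF mid(1) finite_atLeastAtMost] mid(2))
      finally show ?thesis .
    qed
    then have S2: "?L' sums (E - M)"
      using sums_diff[OF even_blocks middle] by simp
    show "summable ?L'"
      using S2 by (rule sums_summable)
    \<comment> \<open>Now \<open>M\<close> is subtracted, so the \<open>q ^ r\<close> part reduces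
      to \<open>ln (1 - q ^ r)\<close>.\<close>
    have "ln (real (fib r)) = (real r - 2) * O1 + (E - M)"
      using \<open>even r\<close> unfolding ln_fib_eq[OF assms] O1_def M_def E_def by (simp add: field_simps)
    then show "ln (real (fib r)) = (\<Sum>k. ?L k) + (\<Sum>k. ?L' k)"
      using S1 S2 by (simp only: sums_unique[symmetric])
  }
qed

end
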